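(* Suppose that $X$ is a complete metric space, $\Gamma\subset\Sigma$ is a compact set satisfying $\sigma(\Gamma)\subset\Gamma$, and $\mu$ is a Borel regular probability measure on $\Gamma$. Let $\{E_{\mathtt{i}}:\mathtt{i}\in\Gamma_*\}$ be a Moran construction in $X$ for which there exists $D\ge1$ such that $\operatorname{diam}(E_{\mathtt{i}\mathtt{j}})\le D\operatorname{diam}(E_{\mathtt{i}})\operatorname{diam}(E_{\mathtt{j}})$ for all $\mathtt{i}\mathtt{j}\in\Gamma_*$, and which satisfies the uniform finite clustering property. Then $$\underline{\dim}_{\mathrm{loc}}(\pi\mu,\pi(\mathtt{i}))=\liminf_{n\to\infty}\frac{\log\mu([\mathtt{i}|_n])}{\log\operatorname{diam}(E_{\mathtt{i}|_n})}$$ for $\mu$-almost all $\mathtt{i}\in\Gamma$.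
   Context: Shift space: $\kappa\ge2$, $\Sigma=\{1,\ldots,\kappa\}^{\mathbb{N}}$, with the metric in which two distinct words are at distance $2^{-n}$, $n$ being the first place at which they differ; $\sigma$ is the left shift. $\mathtt{i}|_n$ is the word of the first $n$ letters of $\mathtt{i}$, $\mathtt{i}|_0=\varnothing$ is the empty word. For $\Gamma\subset\Sigma$, $\Gamma_n=\{\mathtt{i}|_n:\mathtt{i}\in\Gamma\}$ and $\Gamma_*=\bigcup_{n=0}^\infty\Gamma_n$. $\mathtt{i}^-$ is the non-empty finite word $\mathtt{i}$ with last letter removed, and $[\mathtt{i}]=\{\mathtt{i}\mathtt{j}:\mathtt{j}\in\Sigma\}$. Moran construction: a collection $\{E_{\mathtt{i}}:\mathtt{i}\in\Gamma_*\}$ of closed and bounded subsets of $X$ with positive diameter such that $E_{\mathtt{i}}\subset E_{\mathtt{i}^-}$ for all $\mathtt{i}\in\Gamma_*\setminus\{\varnothing\}$ and $\operatorname{diam}(E_{\mathtt{i}|_n})\to0$ as $n\to\infty$ for all $\mathtt{i}\in\Gamma$. The projection $\pi\colon\Gamma\to X$ is defined by $\{\pi(\mathtt{i})\}=\bigcap_{n=1}^\infty E_{\mathtt{i}|_n}$; the limit set is $E=\pi(\Gamma)$. $\pi\mu$ is the push-forward of $\mu$ under $\pi$. Uniform finite clustering property: $\Gamma(r)=\{\mathtt{i}\in\Gamma_*\setminus\{\varnothing\}:\operatorname{diam}(E_{\mathtt{i}})\le r<\operatorname{diam}(E_{\mathtt{i}^-})\}$, $\Gamma(x,r)=\{\mathtt{i}\in\Gamma(r):E_{\mathtt{i}}\cap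 B(x,r)\ne\emptyset\}$ with $B(x,r)$ the closed ball; the property is $\sup_{x\in E}\sup_{r>0}\#\Gamma(x,r)<\infty$. Lower local dimension of a measure $\nu$ at $x$: $\underline{\dim}_{\mathrm{loc}}(\nu,x)=\liminf_{r\downarrow0}\frac{\log\nu(B(x,r))}{\log r}$. *)

theory Defs
  imports "HOL-Probability.Probability"
begin

text \<open>
  Infinite words over the alphabet \<open>{1..\<kappa>}\<close> are streams of natural numbers and finite words are
  lists. Thus the left shift is \<open>stl\<close>, the word of the first \<open>n\<close> letters of \<open>i\<close> is \<open>stake n i\<close>,
  concatenation of a finite with an infinite word is \<open>@-\<close>, and removing the last letter of a
  non-empty finite word is \<open>butlast\<close>.
\<close>

definition shift_space :: "nat \<Rightarrow> nat stream set" where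
  "shift_space \<kappa> = streams {1..\<kappa>}"

text \<open>Places are counted from 1, whereas \<open>!!\<close> counts from 0; hence the \<open>Suc\<close>.\<close>

definition shift_dist :: "'a stream \<Rightarrow> 'a stream \<Rightarrow> real" where
  "shift_dist i j = (if i = j then 0 else (1/2) ^ Suc (LEAST n. i !! n \<noteq> j !! n))"

lemma Metric_space_shift_dist: "Metric_space S shift_dist"
proof
  fix x y z :: "'a stream"
  show "0 \<le> shift_dist x y" by (simp add: shift_dist_def)
  show "shift_dist x y = shift_dist y x" by (simp add: shift_dist_def eq_commute)
  show "shift_dist x y = 0 \<longleftrightarrow> x = y" by (simp add: shift_dist_def)
  show "shift_dist x z \<le> shift_dist x y + shift_dist y z"
  proof (cases "x = y \<or> y = z \<or> x = z")
    case True
    then show ?thesis by (auto simp: shift_dist_def)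
  next
    case False
    let ?L = "\<lambda>u v. LEAST n. u !! n \<noteq> (v :: 'a stream) !! n"
    have differ: "u !! (?L u v) \<noteq> v !! (?L u v)" if "u \<noteq> v" for u v :: "'a stream"
    proof -
      from that have "\<exists>n. u !! n \<noteq> v !! n"
        by (metis stream.expand stream_smap_nats stream.map_cong)
      then show ?thesis by (rule LeastI_ex)
    qed
    have half: "(1/2::real) ^ Suc b \<le> (1/2) ^ Suc a" if "a \<le> b" for a b
      using that by (intro power_decreasing) auto
    have "x !! (?L x z) \<noteq> y !! (?L x z) \<or> y !! (?L x z) \<noteq> z !! (?L x z)"
      using differ[of x z] False by metis
    then have "?L x y \<le> ?L x z \<or> ?L y z \<le> ?L x z"
      by (metis (mono_tags, lifting) Least_le)
    then have "(1/2::real) ^ Suc (?L x z) \<le> (1/2) ^ Suc (?L x y) \<or>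
               (1/2::real) ^ Suc (?L x z) \<le> (1/2) ^ Suc (?L y z)"
      using half by blast
    moreover have "(0::real) \<le> (1/2) ^ Suc (?L x y)" "(0::real) \<le> (1/2) ^ Suc (?L y z)"
      by simp_all
    ultimately have
      "(1/2::real) ^ Suc (?L x z) \<le> (1/2) ^ Suc (?L x y) + (1/2) ^ Suc (?L y z)"
      by linarith
    then show ?thesis
      using False by (simp add: shift_dist_def del: power_Suc)
  qed
qed

abbreviation shift_topology :: "nat \<Rightarrow> nat stream topology" where
  "shift_topology \<kappa> \<equiv> Metric_space.mtopology (shift_space \<kappa>) shift_dist"

definition cylinder :: "nat \<Rightarrow> nat list \<Rightarrow> nat stream set" where
  "cylinder \<kappa> w = (\<lambda>j. w @- j) ` shift_space \<kappa>"

definition words_of_length :: "'a stream set \<Rightarrow> nat \<Rightarrow> 'a list set" where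
  "words_of_length \<Gamma> n = stake n ` \<Gamma>"

definition finite_words :: "'a stream set \<Rightarrow> 'a list set" where
  "finite_words \<Gamma> = (\<Union>n. words_of_length \<Gamma> n)"

definition borel_sets_of :: "'a topology \<Rightarrow> 'a set set" where
  "borel_sets_of T = sigma_sets (topspace T) {U. openin T U}"

text \<open>
  The \<open>\<sigma>\<close>-algebra of the measure may be the Borel \<open>\<sigma>\<close>-algebra or a larger one, such as the
  \<open>\<sigma>\<close>-algebra of Caratheodory measurable sets of a Borel regular outer measure.
\<close>

definition borel_regular_measure_on :: "'a topology \<Rightarrow> 'a measure \<Rightarrow> bool" where
  "borel_regular_measure_on T \<mu> \<longleftrightarrow>
     space \<mu> = topspace T \<and> borel_sets_of T \<subseteq> sets \<mu> \<and>
     (\<forall>A \<in> sets \<mu>. \<exists>B \<in> borel_sets_of T. A \<subseteq> B \<and> emeasure \<mu> B = emeasure \<mu> A)"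

definition moran_construction ::
  "'a stream set \<Rightarrow> ('a list \<Rightarrow> 'x::metric_space set) \<Rightarrow> bool" where
  "moran_construction \<Gamma> E \<longleftrightarrow>
     (\<forall>w \<in> finite_words \<Gamma>. closed (E w) \<and> bounded (E w) \<and> diameter (E w) > 0) \<and>
     (\<forall>w \<in> finite_words \<Gamma> - {[]}. E w \<subseteq> E (butlast w)) \<and>
     (\<forall>i \<in> \<Gamma>. (\<lambda>n. diameter (E (stake n i))) \<longlonglongrightarrow> 0)"

definition projection :: "('a list \<Rightarrow> 'x set) \<Rightarrow> 'a stream \<Rightarrow> 'x" where
  "projection E i = (THE x. {x} = (\<Inter>n\<in>{1..}. E (stake n i)))"

definition limit_set :: "'a stream set \<Rightarrow> ('a list \<Rightarrow> 'x set) \<Rightarrow> 'x set" where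
  "limit_set \<Gamma> E = projection E ` \<Gamma>"

definition level_words ::
  "'a stream set \<Rightarrow> ('a list \<Rightarrow> 'x::metric_space set) \<Rightarrow> real \<Rightarrow> 'a list set" where
  "level_words \<Gamma> E r =
     {w \<in> finite_words \<Gamma> - {[]}. diameter (E w) \<le> r \<and> r < diameter (E (butlast w))}"

definition level_words_near ::
  "'a stream set \<Rightarrow> ('a list \<Rightarrow> 'x::metric_space set) \<Rightarrow> 'x \<Rightarrow> real \<Rightarrow> 'a list set" where
  "level_words_near \<Gamma> E x r = {w \<in> level_words \<Gamma> E r. E w \<inter> cball x r \<noteq> {}}"

definition uniform_finite_clustering ::
  "'a stream set \<Rightarrow> ('a list \<Rightarrow> 'x::metric_space set) \<Rightarrow> bool" where
  "uniform_finite_clustering \<Gamma> E \<longleftrightarrow>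
     (\<exists>N. \<forall>x \<in> limit_set \<Gamma> E. \<forall>r>0.
        finite (level_words_near \<Gamma> E x r) \<and> card (level_words_near \<Gamma> E x r) \<le> N)"

text \<open>
  The logarithm of a mass, with \<open>log 0 = -\<infinity>\<close> (whereas \<open>ln 0 = 0\<close> in the library). With it, the
  quotient \<open>log 0 / log r\<close> is \<open>\<infinity>\<close> for \<open>0 < r < 1\<close>.
\<close>

definition log_mass :: "real \<Rightarrow> ereal" where
  "log_mass t = (if t = 0 then -\<infinity> else ereal (ln t))"

text \<open>Meant for finite \<open>\<nu>\<close>: a ball of infinite mass would have \<open>measure\<close> 0.\<close>

definition lower_local_dim :: "'x::metric_space measure \<Rightarrow> 'x \<Rightarrow> ereal" where
  "lower_local_dim \<nu> x =
     Liminf (at_right 0) (\<lambda>r. log_mass (measure \<nu> (cball x r)) / ereal (ln r))"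

end

theory Submission
  imports Defs
begin

text \<open>
  Write \<open>\<pi>\<close> for the projection, \<open>d\<^sub>n\<close> for the diameter of \<open>E (stake n i)\<close>
  and \<open>[w]\<close> for the set of words of \<open>\<Gamma>\<close> that start with \<open>w\<close>.

  The inequality \<open>\<le>\<close> holds at every \<open>i \<in> \<Gamma>\<close> (\<open>lower_local_dim_le\<close>): the ball around \<open>\<pi> i\<close> of
  radius \<open>d\<^sub>n\<close> contains the image of \<open>[stake n i]\<close>, and \<open>d\<^sub>n\<close> is a particular sequence of radii that
  tends to 0.

  The inequality \<open>\<ge>\<close> can fail at some \<open>i\<close>, because a cylinder of small mass may lie next to one of
  much larger mass. It is enough to see that this happens on a null set. The words of level \<open>r\<close>, those
  at which the diameter first drops to at most \<open>r\<close>, partition \<open>\<Gamma>\<close> once \<open>r\<close> is small. By the clustering property a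
  ball of radius \<open>r\<close> around \<open>\<pi> i\<close> is covered by at most \<open>N\<close> words of level \<open>r\<close>, so one of them, \<open>v\<close>,
  carries at least the \<open>N\<close>-th part of the mass of the ball (\<open>heavy_word_near\<close>). If the inequality
  fails at \<open>i\<close>, there are \<open>s < t\<close> such that for arbitrarily small \<open>r\<close> the word \<open>w\<close> of level \<open>r\<close> that
  starts \<open>i\<close> has mass at most \<open>r\<^sup>t\<close>, while \<open>v\<close> has mass at least a constant times \<open>r\<^sup>s\<close>.

  The total mass of such light words \<open>w\<close> is small (\<open>prob_light_near_heavy\<close>). Since cylinders of one
  level are disjoint, there are at most of the order of \<open>r\<close> to the power \<open>-s\<close> heavy words \<open>v\<close>. Near
  each of them there is a bounded number \<open>C\<close> of words \<open>w\<close>: these meet a ball of radius \<open>2 r\<close>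
  around a point of \<open>E v\<close>, hence extend one of the \<open>N\<close> words of level \<open>2 r\<close> near this point, and
  submultiplicativity of the diameters together with compactness of \<open>\<Gamma>\<close> bounds the number of letters
  between level \<open>2 r\<close> and level \<open>r\<close> (\<open>level_words_extension_le\<close>). So the exceptional words at scale
  \<open>r\<close> have total mass of order at most \<open>r\<close> to the power \<open>t - s\<close>. This is summable over
  \<open>r = (1/2)\<^sup>k\<close>, and the Borel-Cantelli lemma, applied for all rational \<open>s < t\<close>, finishes the proof.
\<close>

section \<open>Quotients of logarithms\<close>

lemma log_mass_quotient_nonneg:
  assumes "0 \<le> m" "m \<le> 1" "0 < r" "r < 1"
  shows "0 \<le> log_mass m / ereal (ln r)"
  using assms by (auto simp: log_mass_def divide_ereal_def divide_nonpos_neg mult_nonpos_nonpos)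

lemma log_mass_quotient_antimono:
  assumes "0 \<le> m" "m \<le> m'" "0 < r" "r < 1"
  shows "log_mass m' / ereal (ln r) \<le> log_mass m / ereal (ln r)"
  using assms by (auto simp: log_mass_def divide_ereal_def divide_right_mono_neg mult_right_mono_neg)

lemma powr_less_if_log_mass_quotient_less:
  assumes "0 \<le> m" "0 < r" "r < 1" "log_mass m / ereal (ln r) < ereal s"
  shows "r powr s < m"
proof -
  from assms have m: "m > 0"
    by (cases "m = 0") (auto simp: log_mass_def divide_ereal_def)
  with assms have "ln m / ln r < s" by (simp add: log_mass_def)
  with assms have "s * ln r < ln m" by (simp add: neg_divide_less_eq)
  then have "exp (s * ln r) < m" using m by (metis exp_less_mono exp_ln)
  then show ?thesis using assms by (simp add: powr_def)
qed

lemma less_powr_if_less_log_mass_quotient: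
  assumes "0 \<le> m" "0 < r" "r < 1" "ereal t < log_mass m / ereal (ln r)"
  shows "m < r powr t"
proof (cases "m = 0")
  case False
  with assms have "t < ln m / ln r" by (simp add: log_mass_def)
  with assms have "ln m < t * ln r" by (simp add: neg_less_divide_eq)
  then have "m < exp (t * ln r)" using False assms by (metis exp_less_mono exp_ln less_eq_real_def)
  then show ?thesis using assms by (simp add: powr_def)
qed (use assms in simp)

lemma Liminf_le_Liminf_compose:
  fixes f :: "'a \<Rightarrow> 'b :: complete_linorder"
  assumes "filterlim g F G"
  shows "Liminf F f \<le> Liminf G (\<lambda>x. f (g x))"
  unfolding le_Liminf_iff
  using assms by (auto dest!: less_LiminfD simp: filterlim_iff)

section \<open>Moran constructions and words of a given level\<close>

lemma stake_in_finite_words [simp, intro]: "i \<in> \<Gamma> \<Longrightarrow> stake n i \<in> finite_words \<Gamma>"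
  by (auto simp: finite_words_def words_of_length_def)

lemma finite_wordsE:
  assumes "w \<in> finite_words \<Gamma>"
  obtains i where "i \<in> \<Gamma>" "w = stake (length w) i"
  using assms by (auto simp: finite_words_def words_of_length_def)

text \<open>
  The trace on \<open>\<Gamma>\<close> of the cylinder of \<open>w\<close>, in a form that does not refer to the alphabet; see
  \<open>cylinder_Int_eq_cylinder_in\<close>.
\<close>

definition cylinder_in :: "'a stream set \<Rightarrow> 'a list \<Rightarrow> 'a stream set" where
  "cylinder_in \<Gamma> w = {i \<in> \<Gamma>. stake (length w) i = w}"

locale moran =
  fixes \<Gamma> :: "'a stream set" and E :: "'a list \<Rightarrow> 'x::complete_space set"
  assumes moran: "moran_construction \<Gamma> E"
begin

lemma closed_E: "w \<in> finite_words \<Gamma> \<Longrightarrow> closed (E w)"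
  and bounded_E: "w \<in> finite_words \<Gamma> \<Longrightarrow> bounded (E w)"
  and diameter_E_pos: "w \<in> finite_words \<Gamma> \<Longrightarrow> diameter (E w) > 0"
  and diameter_E_tendsto: "i \<in> \<Gamma> \<Longrightarrow> (\<lambda>n. diameter (E (stake n i))) \<longlonglongrightarrow> 0"
  using moran by (auto simp: moran_construction_def)

lemma E_stake_mono:
  assumes i: "i \<in> \<Gamma>" and "m \<le> n"
  shows "E (stake n i) \<subseteq> E (stake m i)"
proof (rule lift_Suc_antimono_le[OF _ \<open>m \<le> n\<close>])
  fix n
  have "E (stake (Suc n) i) \<subseteq> E (butlast (stake (Suc n) i))"
    using moran i stake_in_finite_words[OF i, of "Suc n"] unfolding moran_construction_def
    by (metis Diff_iff empty_iff insert_iff stake_invert_Nil nat.distinct(1))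
  then show "E (stake (Suc n) i) \<subseteq> E (stake n i)" by (simp only: stake_Suc butlast_snoc)
qed

lemma diameter_E_stake_mono:
  "i \<in> \<Gamma> \<Longrightarrow> m \<le> n \<Longrightarrow> diameter (E (stake n i)) \<le> diameter (E (stake m i))"
  by (intro diameter_subset E_stake_mono bounded_E) auto

lemma dist_le_diameter_E:
  "w \<in> finite_words \<Gamma> \<Longrightarrow> x \<in> E w \<Longrightarrow> y \<in> E w \<Longrightarrow> dist x y \<le> diameter (E w)"
  by (rule diameter_bounded_bound[OF bounded_E])

text \<open>
  Completeness of the space enters here, through Cantor's intersection theorem: without it the
  definite description in \<^const>\<open>projection\<close> could be void. The intersection that defines the projection
  leaves out the empty word, but the sets decrease, so the point lies in \<open>E []\<close> as well.
\<close>

lemma projection_in: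
  assumes i: "i \<in> \<Gamma>"
  shows "projection E i \<in> E (stake n i)"
proof -
  have "\<exists>x. \<Inter> (range (\<lambda>n. E (stake n i))) = {x}"
  proof (rule decreasing_closed_nest_sing)
    show "closed (E (stake n i))" for n using i by (intro closed_E) auto
    show "E (stake n i) \<noteq> {}" for n
      using diameter_E_pos[OF stake_in_finite_words[OF i, of n]] by auto
    show "E (stake n i) \<subseteq> E (stake m i)" if "m \<le> n" for m n by (rule E_stake_mono[OF i that])
    fix e :: real assume "e > 0"
    from order_tendstoD(2)[OF diameter_E_tendsto[OF i] this] obtain n
      where "diameter (E (stake n i)) < e" by (auto simp: eventually_sequentially)
    then show "\<exists>n. \<forall>x\<in>E (stake n i). \<forall>y\<in>E (stake n i). dist x y < e"
      using dist_le_diameter_E[OF stake_in_finite_words[OF i]] by (meson le_less_trans)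
  qed
  then obtain x where x: "(\<Inter>n. E (stake n i)) = {x}" by auto
  have "(\<Inter>n\<in>{1..}. E (stake n i)) = (\<Inter>n. E (stake n i))"
  proof -
    have "x \<in> E (stake n i)" if "x \<in> (\<Inter>n\<in>{1..}. E (stake n i))" for x n
      using that E_stake_mono[OF i, of n "Suc n"] by fastforce
    then show ?thesis by blast
  qed
  then have "projection E i = x" unfolding projection_def using x by auto
  then show ?thesis using x by auto
qed

text \<open>
  For \<open>r\<close> below the diameter of \<open>E []\<close>, the words of level \<open>r\<close> cover \<open>\<Gamma>\<close>: the diameters along \<open>i\<close>
  start above \<open>r\<close> and tend to 0. By \<open>level_word_length_unique\<close> no other prefix
  of \<open>i\<close> has level \<open>r\<close>, so that the words of level \<open>r\<close> partition \<open>\<Gamma>\<close>.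
\<close>

lemma level_word_exists:
  assumes i: "i \<in> \<Gamma>" and "r > 0" and r: "r < diameter (E [])"
  shows "\<exists>n. stake n i \<in> level_words \<Gamma> E r"
proof -
  let ?P = "\<lambda>n. diameter (E (stake n i)) \<le> r"
  obtain m where m: "?P m"
    using order_tendstoD(2)[OF diameter_E_tendsto[OF i] \<open>r > 0\<close>]
    by (auto simp: eventually_sequentially intro: less_imp_le)
  have "\<not> ?P 0" using r by simp
  from ex_least_nat_less[OF m this] obtain n where "\<not> ?P n" "?P (Suc n)" by blast
  moreover have "butlast (stake (Suc n) i) = stake n i" by (simp only: stake_Suc butlast_snoc)
  ultimately have "stake (Suc n) i \<in> level_words \<Gamma> E r"
    using stake_in_finite_words[OF i, of "Suc n"] by (simp add: level_words_def del: stake.simps)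
  then show ?thesis ..
qed

lemma level_word_le:
  assumes i: "i \<in> \<Gamma>" and "stake n i \<in> level_words \<Gamma> E r" and m: "diameter (E (stake m i)) \<le> r"
  shows "n \<le> m"
proof (rule ccontr)
  assume "\<not> n \<le> m"
  then obtain k where k: "n = Suc k" "m \<le> k" by (metis less_imp_Suc_add not_le le_add1)
  then have "r < diameter (E (stake k i))"
    using assms(2) by (auto simp: level_words_def stake_Suc simp del: stake.simps)
  with diameter_E_stake_mono[OF i k(2)] m show False by simp
qed

lemma level_word_length_unique:
  assumes "i \<in> \<Gamma>" "stake m i \<in> level_words \<Gamma> E r" "stake n i \<in> level_words \<Gamma> E r"
  shows "m = n"
  using assms level_word_le[of i n r m] level_word_le[of i m r n] by (auto simp: level_words_def)

lemma cylinder_in_level_word_nonempty: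
  assumes "w \<in> level_words \<Gamma> E r"
  shows "cylinder_in \<Gamma> w \<noteq> {}"
proof -
  obtain i where "i \<in> \<Gamma>" "w = stake (length w) i"
    using assms by (auto simp: level_words_def elim: finite_wordsE)
  then have "i \<in> cylinder_in \<Gamma> w" by (simp add: cylinder_in_def)
  then show ?thesis by blast
qed

lemma projection_cylinder_in: "i \<in> cylinder_in \<Gamma> w \<Longrightarrow> projection E i \<in> E w"
  using projection_in[of i "length w"] by (auto simp: cylinder_in_def)

lemma disjoint_level_words: "disjoint_family_on (cylinder_in \<Gamma>) (level_words \<Gamma> E r)"
proof -
  have "v = w" if "v \<in> level_words \<Gamma> E r" "w \<in> level_words \<Gamma> E r" "i \<in> \<Gamma>"
    "stake (length v) i = v" "stake (length w) i = w" for v w i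
  proof -
    have "length v = length w"
      using that by (intro level_word_length_unique[of i _ r]) simp_all
    with that(4,5) show ?thesis by metis
  qed
  then show ?thesis unfolding disjoint_family_on_def cylinder_in_def by blast
qed

end

section \<open>Cylinders in the shift topology\<close>

lemma cylinder_Int_eq_cylinder_in:
  assumes "\<Gamma> \<subseteq> shift_space \<kappa>"
  shows "cylinder \<kappa> w \<inter> \<Gamma> = cylinder_in \<Gamma> w"
proof -
  have "i \<in> cylinder \<kappa> w" if "i \<in> \<Gamma>" "stake (length w) i = w" for i
  proof -
    have "sdrop (length w) i \<in> shift_space \<kappa>"
    proof -
      have "sset (sdrop (length w) i) \<subseteq> sset i" by (metis stake_sdrop sset_shift Un_upper2)
      then show ?thesis using that assms subsetD[of \<Gamma> "shift_space \<kappa>" i]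
        unfolding shift_space_def streams_iff_sset by blast
    qed
    moreover have "i = w @- sdrop (length w) i"
      using stake_sdrop[of "length w" i] that by simp
    ultimately show ?thesis unfolding cylinder_def by blast
  qed
  moreover have "stake (length w) i = w" if "i \<in> cylinder \<kappa> w" for i
    using that by (auto simp: cylinder_def stake_shift)
  ultimately show ?thesis unfolding cylinder_in_def by blast
qed

lemma stake_eq_if_shift_dist_less:
  assumes "shift_dist i j < (1/2) ^ n"
  shows "stake n i = stake n j"
proof (cases "i = j")
  case False
  let ?L = "LEAST n. i !! n \<noteq> j !! n"
  have "n \<le> ?L"
  proof (rule ccontr)
    assume "\<not> n \<le> ?L"
    then have "(1/2::real) ^ n \<le> (1/2) ^ Suc ?L" by (intro power_decreasing) auto
    with assms False show False by (simp add: shift_dist_def)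
  qed
  then have "i !! m = j !! m" if "m < n" for m
    using not_less_Least[of m "\<lambda>n. i !! n \<noteq> j !! n"] that by auto
  then show ?thesis by (intro nth_equalityI) auto
qed simp

lemma openin_cylinder_in: "openin (shift_topology \<kappa>) (cylinder_in (shift_space \<kappa>) w)"
proof -
  interpret Metric_space "shift_space \<kappa>" shift_dist by (rule Metric_space_shift_dist)
  have "mball i ((1/2) ^ length w) \<subseteq> cylinder_in (shift_space \<kappa>) w"
    if "i \<in> cylinder_in (shift_space \<kappa>) w" for i
    using that stake_eq_if_shift_dist_less[of i _ "length w"] by (auto simp: cylinder_in_def)
  then show ?thesis
    unfolding openin_mtopology
    by (auto simp: cylinder_in_def intro!: exI[of _ "(1/2) ^ length w"])
qed

section \<open>Words between two levels\<close>

text \<open>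
  A Dini argument: the diameters decrease along every word of \<open>\<Gamma>\<close>, and the cylinders on which they have
  fallen below \<open>\<epsilon>\<close> form an open cover of the compact set \<open>\<Gamma>\<close>; the longest word of a finite subcover
  gives the length \<open>k\<close>.
\<close>

lemma diameter_uniformly_small:
  fixes E :: "nat list \<Rightarrow> 'x::complete_space set"
  assumes "moran \<Gamma> E" and comp: "compactin (shift_topology \<kappa>) \<Gamma>" and "\<epsilon> > 0"
  shows "\<exists>k. \<forall>u \<in> words_of_length \<Gamma> k. diameter (E u) \<le> \<epsilon>"
proof -
  interpret moran \<Gamma> E by fact
  interpret Metric_space "shift_space \<kappa>" shift_dist by (rule Metric_space_shift_dist)
  let ?W = "{w. diameter (E w) < \<epsilon>}"
  have "\<Gamma> \<subseteq> (\<Union>w\<in>?W. cylinder_in (shift_space \<kappa>) w)"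
  proof
    fix i assume i: "i \<in> \<Gamma>"
    from order_tendstoD(2)[OF diameter_E_tendsto[OF i] \<open>\<epsilon> > 0\<close>] obtain n
      where "diameter (E (stake n i)) < \<epsilon>" by (auto simp: eventually_sequentially)
    moreover have "i \<in> shift_space \<kappa>" using i comp by (auto simp: compactin_def)
    ultimately show "i \<in> (\<Union>w\<in>?W. cylinder_in (shift_space \<kappa>) w)"
      by (auto simp: cylinder_in_def intro!: exI[of _ "stake n i"])
  qed
  then obtain \<F> where F: "finite \<F>" "\<F> \<subseteq> cylinder_in (shift_space \<kappa>) ` ?W" "\<Gamma> \<subseteq> \<Union>\<F>"
    using comp[unfolded compactin_def, THEN conjunct2, rule_format,
        of "cylinder_in (shift_space \<kappa>) ` ?W"] openin_cylinder_in by auto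
  obtain W where W: "finite W" "W \<subseteq> ?W" "\<F> = cylinder_in (shift_space \<kappa>) ` W"
    using finite_subset_image[OF F(1,2)] by blast
  define k where "k = Max (insert 0 (length ` W))"
  have "diameter (E (stake k i)) \<le> \<epsilon>" if i: "i \<in> \<Gamma>" for i
  proof -
    obtain w where w: "w \<in> W" "stake (length w) i = w"
      using W(3) F(3) i by (auto simp: cylinder_in_def)
    have "length w \<le> k" unfolding k_def using W(1) w(1) by (intro Max_ge) auto
    from diameter_E_stake_mono[OF i this] show ?thesis using w W(2) by auto
  qed
  then show ?thesis by (auto simp: words_of_length_def)
qed

text \<open>
  After level \<open>2 r\<close>, any \<open>k\<close> further letters multiply the diameter by at most \<open>D / (2 D) = 1 / 2\<close>,
  and so bring it down to \<open>r\<close>: level \<open>r\<close> has been reached. The further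
  letters form a word of \<open>\<Gamma>\<close> because \<open>\<Gamma>\<close> is shift invariant.
\<close>

lemma (in moran) level_words_extension_le:
  assumes shift: "stl ` \<Gamma> \<subseteq> \<Gamma>" and "D \<ge> 1"
    and submult: "\<And>u v. u @ v \<in> finite_words \<Gamma> \<Longrightarrow>
      diameter (E (u @ v)) \<le> D * diameter (E u) * diameter (E v)"
    and small: "\<And>u. u \<in> words_of_length \<Gamma> k \<Longrightarrow> diameter (E u) \<le> 1 / (2 * D)"
    and i: "i \<in> \<Gamma>" and m: "stake m i \<in> level_words \<Gamma> E (2 * r)"
    and n: "stake n i \<in> level_words \<Gamma> E r"
  shows "n \<le> m + k"
proof (rule level_word_le[OF i n])
  have "sdrop m i \<in> \<Gamma>"
  proof (induction m)
    case (Suc m)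
    then have "stl (sdrop m i) \<in> \<Gamma>" using shift by blast
    then show ?case by (metis sdrop_stl sdrop.simps(2))
  qed (use i in simp)
  then have "diameter (E (stake k (sdrop m i))) \<le> 1 / (2 * D)"
    by (intro small) (auto simp: words_of_length_def)
  moreover have "diameter (E (stake m i)) \<le> 2 * r" using m by (simp add: level_words_def)
  ultimately have "diameter (E (stake m i)) * diameter (E (stake k (sdrop m i)))
      \<le> 2 * r * (1 / (2 * D))"
    using diameter_E_pos[OF stake_in_finite_words[OF i, of m]]
      diameter_E_pos[OF stake_in_finite_words[OF \<open>sdrop m i \<in> \<Gamma>\<close>, of k]]
    by (intro mult_mono) auto
  then have "D * diameter (E (stake m i)) * diameter (E (stake k (sdrop m i))) \<le> D * (2 * r * (1 / (2 * D)))"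
    using \<open>D \<ge> 1\<close> by (simp only: mult.assoc) (intro mult_left_mono, auto)
  also have "\<dots> = r" using \<open>D \<ge> 1\<close> by simp
  finally show "diameter (E (stake (m + k) i)) \<le> r"
    using submult[of "stake m i" "stake k (sdrop m i)"] i by (simp add: stake_add)
qed

text \<open>
  The clustering property bounds the number of words of level \<open>r\<close> near a ball of radius \<open>r\<close>; this lemma
  carries the bound over to balls of radius \<open>2 r\<close>. A word of level \<open>r\<close> that comes close to \<open>x\<close> is an
  extension, by at most \<open>k\<close> letters, of a word of level \<open>2 r\<close> that comes close to \<open>x\<close>.
\<close>

lemma (in moran) level_words_near_double_radius:
  assumes "finite A" and "\<Gamma> \<subseteq> streams A"
    and ext: "\<And>i m n r. i \<in> \<Gamma> \<Longrightarrow> stake m i \<in> level_words \<Gamma> E (2 * r) \<Longrightarrow>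
      stake n i \<in> level_words \<Gamma> E r \<Longrightarrow> n \<le> m + k"
    and fin: "finite (level_words_near \<Gamma> E x (2 * r))"
    and "card (level_words_near \<Gamma> E x (2 * r)) \<le> N" "0 < r" "2 * r < diameter (E [])"
  shows "finite {w \<in> level_words \<Gamma> E r. E w \<inter> cball x (2 * r) \<noteq> {}}" (is "finite ?S")
    and "card {w \<in> level_words \<Gamma> E r. E w \<inter> cball x (2 * r) \<noteq> {}}
      \<le> N * card {u. set u \<subseteq> A \<and> length u \<le> k}"
proof -
  let ?L = "{u. set u \<subseteq> A \<and> length u \<le> k}"
  let ?T = "level_words_near \<Gamma> E x (2 * r) \<times> ?L"
  have finL: "finite ?L" using \<open>finite A\<close> by (rule finite_lists_length_le)
  have sub: "?S \<subseteq> (\<lambda>(v, u). v @ u) ` ?T"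
  proof
    fix w assume w: "w \<in> ?S"
    then obtain i where i: "i \<in> \<Gamma>" "w = stake (length w) i"
      by (auto simp: level_words_def elim!: finite_wordsE)
    obtain m where m: "stake m i \<in> level_words \<Gamma> E (2 * r)"
      using level_word_exists[OF i(1), of "2 * r"] \<open>0 < r\<close> \<open>2 * r < diameter (E [])\<close> by auto
    have w': "stake (length w) i \<in> level_words \<Gamma> E r" using w i by simp
    then have "diameter (E (stake (length w) i)) \<le> 2 * r"
      using \<open>0 < r\<close> by (simp add: level_words_def)
    from level_word_le[OF i(1) m this] have mw: "m \<le> length w" .
    define u where "u = stake (length w - m) (sdrop m i)"
    have "w = stake m i @ u" using mw i(2) by (simp add: u_def stake_add)
    moreover have "length u \<le> k" using ext[OF i(1) m w'] by (simp add: u_def)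
    moreover have "set u \<subseteq> A"
    proof -
      have "set (stake (length w) i) \<subseteq> sset i"
        by (metis stake_sdrop sset_shift Un_upper1)
      also have "sset i \<subseteq> A" using subsetD[OF assms(2) i(1)] by (simp add: streams_iff_sset)
      finally show ?thesis using \<open>w = stake m i @ u\<close> i(2)
        by (metis le_sup_iff set_append)
    qed
    moreover have "stake m i \<in> level_words_near \<Gamma> E x (2 * r)"
      using m w E_stake_mono[OF i(1) mw] i(2) by (auto simp: level_words_near_def)
    ultimately show "w \<in> (\<lambda>(v, u). v @ u) ` ?T" by force
  qed
  show "finite ?S" by (rule finite_subset[OF sub]) (use fin finL in auto)
  have "card ?S \<le> card ((\<lambda>(v, u). v @ u) ` ?T)"
    by (rule card_mono[OF _ sub]) (use fin finL in auto)
  also have "\<dots> \<le> card ?T" by (rule card_image_le) (use fin finL in auto)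
  also have "\<dots> \<le> N * card ?L" using assms(5) by (simp add: card_cartesian_product)
  finally show "card ?S \<le> N * card ?L" .
qed


section \<open>The image measure and the upper bound for the dimension\<close>

locale moran_measure = moran \<Gamma> E + prob_space \<mu>
  for \<Gamma> :: "'a::countable stream set" and E :: "'a list \<Rightarrow> 'x::complete_space set"
    and \<mu> :: "'a stream measure" +
  assumes space_eq: "space \<mu> = \<Gamma>"
    and cylinder_in_sets [measurable]: "cylinder_in \<Gamma> w \<in> sets \<mu>"
begin

text \<open>
  The projection is continuous, and the preimage of an open set is a union of countably many cylinders
  because there are only countably many finite words.
\<close>

lemma projection_measurable [measurable]: "projection E \<in> borel_measurable \<mu>"
proof (rule borel_measurableI)
  fix U :: "'x set" assume "open U"
  let ?W = "{w. cylinder_in \<Gamma> w \<subseteq> projection E -` U}"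
  have "i \<in> (\<Union>w\<in>?W. cylinder_in \<Gamma> w)" if i: "i \<in> \<Gamma>" "projection E i \<in> U" for i
  proof -
    obtain e where e: "e > 0" "ball (projection E i) e \<subseteq> U"
      using \<open>open U\<close> i(2) by (auto simp: open_contains_ball)
    from order_tendstoD(2)[OF diameter_E_tendsto[OF i(1)] e(1)] obtain n
      where n: "diameter (E (stake n i)) < e" by (auto simp: eventually_sequentially)
    have "projection E j \<in> U" if "j \<in> cylinder_in \<Gamma> (stake n i)" for j
    proof -
      have "dist (projection E i) (projection E j) \<le> diameter (E (stake n i))"
        using projection_cylinder_in[OF that] projection_in[OF i(1)] i(1)
        by (intro dist_le_diameter_E) auto
      with n e(2) show ?thesis by (auto simp: subset_iff)
    qed
    then show ?thesis using i(1) by (intro UN_I[of "stake n i"]) (auto simp: cylinder_in_def)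
  qed
  then have "projection E -` U \<inter> space \<mu> = (\<Union>w\<in>?W. cylinder_in \<Gamma> w)"
    by (auto simp: space_eq) (auto simp: cylinder_in_def)
  also have "\<dots> \<in> sets \<mu>" by (intro sets.countable_UN') auto
  finally show "projection E -` U \<inter> space \<mu> \<in> sets \<mu>" .
qed

definition image_measure :: "'x measure" where
  "image_measure = distr \<mu> borel (projection E)"

lemma measure_image_measure_cball:
  "measure image_measure (cball x r) = prob (projection E -` cball x r \<inter> \<Gamma>)"
  unfolding image_measure_def using measure_distr[of "projection E" \<mu> borel "cball x r"]
  by (simp add: space_eq)

lemma projection_vimage_cball_sets [measurable]: "projection E -` cball x r \<inter> \<Gamma> \<in> sets \<mu>"
  using measurable_sets[OF projection_measurable, of "cball x r"] by (simp add: space_eq)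

lemma measure_cylinder_le_ball:
  assumes i: "i \<in> \<Gamma>"
  shows "prob (cylinder_in \<Gamma> (stake n i))
    \<le> measure image_measure (cball (projection E i) (diameter (E (stake n i))))"
  unfolding measure_image_measure_cball
proof (rule finite_measure_mono)
  show "cylinder_in \<Gamma> (stake n i)
      \<subseteq> projection E -` cball (projection E i) (diameter (E (stake n i))) \<inter> \<Gamma>"
    using projection_in[OF i] projection_cylinder_in dist_le_diameter_E[OF stake_in_finite_words[OF i]]
    by (auto simp: cylinder_in_def)
qed measurable

text \<open>
  The quotient decreases when the mass increases, as the logarithm of the radius is negative. Hence
  \<open>measure_cylinder_le_ball\<close> compares the two sides along the radii \<open>diameter (E (stake n i))\<close>.
\<close>

lemma lower_local_dim_le:
  assumes i: "i \<in> \<Gamma>"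
  shows "lower_local_dim image_measure (projection E i)
    \<le> liminf (\<lambda>n. log_mass (prob (cylinder_in \<Gamma> (stake n i))) / ereal (ln (diameter (E (stake n i)))))"
proof -
  let ?d = "\<lambda>n. diameter (E (stake n i))"
  have pos: "?d n > 0" for n using i by (intro diameter_E_pos) auto
  have "filterlim ?d (at_right 0) sequentially"
    unfolding filterlim_at using diameter_E_tendsto[OF i] pos less_imp_neq[OF pos] by simp
  from Liminf_le_Liminf_compose[OF this]
  have "lower_local_dim image_measure (projection E i)
      \<le> liminf (\<lambda>n. log_mass (measure image_measure (cball (projection E i) (?d n))) / ereal (ln (?d n)))"
    unfolding lower_local_dim_def .
  also have "\<dots> \<le> liminf (\<lambda>n. log_mass (prob (cylinder_in \<Gamma> (stake n i))) / ereal (ln (?d n)))"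
  proof (rule Liminf_mono)
    have "eventually (\<lambda>n. ?d n < 1) sequentially"
      using order_tendstoD(2)[OF diameter_E_tendsto[OF i], of 1] by simp
    then show "eventually (\<lambda>n. log_mass (measure image_measure (cball (projection E i) (?d n))) / ereal (ln (?d n))
        \<le> log_mass (prob (cylinder_in \<Gamma> (stake n i))) / ereal (ln (?d n))) sequentially"
      by eventually_elim
        (intro log_mass_quotient_antimono measure_cylinder_le_ball i pos measure_nonneg)
  qed
  finally show ?thesis .
qed

section \<open>Light words near heavy words\<close>

text \<open>
  Pigeonhole principle: the words of level \<open>r\<close> that come close to \<open>\<pi> i\<close> cover the preimage of the ball,
  and there are at most \<open>N\<close> of them.
\<close>

lemma heavy_word_near:
  assumes i: "i \<in> \<Gamma>" and r: "0 < r" "r < diameter (E [])"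
    and fin: "finite (level_words_near \<Gamma> E (projection E i) r)"
    and card: "card (level_words_near \<Gamma> E (projection E i) r) \<le> N"
  shows "\<exists>w \<in> level_words_near \<Gamma> E (projection E i) r.
    measure image_measure (cball (projection E i) r) \<le> N * prob (cylinder_in \<Gamma> w)"
proof (rule ccontr)
  let ?L = "level_words_near \<Gamma> E (projection E i) r"
  let ?m = "measure image_measure (cball (projection E i) r)"
  assume "\<not> ?thesis"
  then have light: "N * prob (cylinder_in \<Gamma> w) < ?m" if "w \<in> ?L" for w
    using that by (auto simp: not_le)
  have sub: "projection E -` cball (projection E i) r \<inter> \<Gamma> \<subseteq> (\<Union>w\<in>?L. cylinder_in \<Gamma> w)"
  proof
    fix j assume j: "j \<in> projection E -` cball (projection E i) r \<inter> \<Gamma>"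
    then obtain n where "stake n j \<in> level_words \<Gamma> E r" using level_word_exists[of j r] r by auto
    with j projection_in[of j n] have "stake n j \<in> ?L" by (auto simp: level_words_near_def)
    with j show "j \<in> (\<Union>w\<in>?L. cylinder_in \<Gamma> w)"
      by (intro UN_I[of "stake n j"]) (auto simp: cylinder_in_def)
  qed
  moreover have "i \<in> projection E -` cball (projection E i) r \<inter> \<Gamma>" using i r by simp
  ultimately have ne: "?L \<noteq> {}" by blast
  have "?m \<le> prob (\<Union>w\<in>?L. cylinder_in \<Gamma> w)"
    unfolding measure_image_measure_cball using sub fin by (intro finite_measure_mono) auto
  also have "\<dots> \<le> (\<Sum>w\<in>?L. prob (cylinder_in \<Gamma> w))"
    using fin by (intro finite_measure_subadditive_finite) auto
  finally have "N * ?m \<le> (\<Sum>w\<in>?L. N * prob (cylinder_in \<Gamma> w))"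
    by (simp add: sum_distrib_left[symmetric] mult_left_mono)
  also have "\<dots> < (\<Sum>w\<in>?L. ?m)" using light fin ne by (intro sum_strict_mono) auto
  also have "\<dots> \<le> N * ?m" using card by (simp add: mult_right_mono)
  finally show False by simp
qed

text \<open>
  The exceptional set at scale \<open>r\<close>, with \<open>a\<close> the mass from which a word counts as heavy and \<open>b\<close> the
  mass up to which it counts as light. It is written as a union of cylinders so that it is measurable;
  membership of \<open>i\<close> depends on the prefix of \<open>i\<close> of level \<open>r\<close> alone. The union is indexed first by
  the heavy words because these are the ones that can be counted.
\<close>

definition light_near_heavy :: "real \<Rightarrow> real \<Rightarrow> real \<Rightarrow> 'a stream set" where
  "light_near_heavy r a b =
     (\<Union>v \<in> {v \<in> level_words \<Gamma> E r. a \<le> prob (cylinder_in \<Gamma> v)}.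
      \<Union>w \<in> {w \<in> level_words \<Gamma> E r. prob (cylinder_in \<Gamma> w) \<le> b \<and>
              (\<exists>i \<in> cylinder_in \<Gamma> w. v \<in> level_words_near \<Gamma> E (projection E i) r)}.
        cylinder_in \<Gamma> w)"

lemma light_near_heavy_sets [measurable]: "light_near_heavy r a b \<in> sets \<mu>"
  unfolding light_near_heavy_def by (intro sets.countable_UN') auto

lemma card_heavy_words:
  assumes "a > 0"
  shows "finite {v \<in> level_words \<Gamma> E r. a \<le> prob (cylinder_in \<Gamma> v)} \<and>
    card {v \<in> level_words \<Gamma> E r. a \<le> prob (cylinder_in \<Gamma> v)} \<le> nat \<lfloor>1 / a\<rfloor>"
proof (rule finite_if_finite_subsets_card_bdd)
  fix F assume F: "F \<subseteq> {v \<in> level_words \<Gamma> E r. a \<le> prob (cylinder_in \<Gamma> v)}" "finite F"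
  have "card F * a = (\<Sum>v\<in>F. a)" by simp
  also have "\<dots> \<le> (\<Sum>v\<in>F. prob (cylinder_in \<Gamma> v))" using F by (intro sum_mono) auto
  also have "\<dots> = prob (\<Union>v\<in>F. cylinder_in \<Gamma> v)"
    using F disjoint_family_on_mono[OF _ disjoint_level_words, of F r]
    by (intro finite_measure_finite_Union[symmetric]) auto
  also have "\<dots> \<le> 1" by (rule prob_le_1)
  finally have "real (card F) \<le> 1 / a" using assms by (simp add: pos_le_divide_eq)
  then show "card F \<le> nat \<lfloor>1 / a\<rfloor>" by (simp add: le_nat_floor)
qed

text \<open>
  There are at most \<open>1 / a\<close> heavy words by disjointness, and each light word near the heavy word \<open>v\<close>
  meets the ball of radius \<open>2 r\<close> around a point of \<open>E v\<close> chosen in advance: one \<open>r\<close> accounts for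
  the distance between the two sets, the other for the diameter of \<open>E v\<close>.
\<close>

lemma prob_light_near_heavy:
  assumes "a > 0" "b \<ge> 0"
    and mult: "\<And>x. x \<in> limit_set \<Gamma> E \<Longrightarrow>
      finite {w \<in> level_words \<Gamma> E r. E w \<inter> cball x (2 * r) \<noteq> {}} \<and>
      card {w \<in> level_words \<Gamma> E r. E w \<inter> cball x (2 * r) \<noteq> {}} \<le> C"
  shows "prob (light_near_heavy r a b) \<le> C * b / a"
proof -
  let ?H = "{v \<in> level_words \<Gamma> E r. a \<le> prob (cylinder_in \<Gamma> v)}"
  let ?P = "\<lambda>v. {w \<in> level_words \<Gamma> E r. prob (cylinder_in \<Gamma> w) \<le> b \<and>
              (\<exists>i \<in> cylinder_in \<Gamma> w. v \<in> level_words_near \<Gamma> E (projection E i) r)}"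
  have H: "finite ?H" "card ?H \<le> nat \<lfloor>1 / a\<rfloor>" using card_heavy_words[OF \<open>a > 0\<close>] by auto
  have P: "prob (\<Union>w\<in>?P v. cylinder_in \<Gamma> w) \<le> C * b" if v: "v \<in> ?H" for v
  proof -
    obtain j where j: "j \<in> cylinder_in \<Gamma> v"
      using v cylinder_in_level_word_nonempty by blast
    let ?x = "projection E j"
    let ?S = "{w \<in> level_words \<Gamma> E r. E w \<inter> cball ?x (2 * r) \<noteq> {}}"
    have "?x \<in> limit_set \<Gamma> E" using j by (auto simp: limit_set_def cylinder_in_def)
    from mult[OF this] have S: "finite ?S" "card ?S \<le> C" by auto
    have sub: "?P v \<subseteq> ?S"
    proof
      fix w assume "w \<in> ?P v"
      then obtain i where w: "w \<in> level_words \<Gamma> E r" and i: "i \<in> cylinder_in \<Gamma> w"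
        and "v \<in> level_words_near \<Gamma> E (projection E i) r" by blast
      then obtain y where y: "y \<in> E v" "dist (projection E i) y \<le> r"
        by (auto simp: level_words_near_def)
      have "dist ?x y \<le> diameter (E v)"
        using v y(1) projection_cylinder_in[OF j]
        by (intro dist_le_diameter_E) (auto simp: level_words_def)
      also have "\<dots> \<le> r" using v by (simp add: level_words_def)
      finally have "dist ?x (projection E i) \<le> 2 * r"
        using y(2) dist_triangle[of ?x "projection E i" y] by (simp add: dist_commute)
      then show "w \<in> ?S" using w projection_cylinder_in[OF i] by auto
    qed
    have fin: "finite (?P v)" using sub S(1) by (rule finite_subset)
    have "prob (\<Union>w\<in>?P v. cylinder_in \<Gamma> w) \<le> (\<Sum>w\<in>?P v. prob (cylinder_in \<Gamma> w))"
      by (rule finite_measure_subadditive_finite[OF fin]) auto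
    also have "\<dots> \<le> card (?P v) * b" by (rule sum_bounded_above) auto
    also have "\<dots> \<le> C * b"
      using card_mono[OF S(1) sub] S(2) \<open>b \<ge> 0\<close> by (intro mult_right_mono) auto
    finally show ?thesis .
  qed
  have "prob (light_near_heavy r a b) \<le> (\<Sum>v\<in>?H. prob (\<Union>w\<in>?P v. cylinder_in \<Gamma> w))"
    unfolding light_near_heavy_def
    by (rule finite_measure_subadditive_finite[OF H(1)]) (auto intro!: sets.countable_UN')
  also have "\<dots> \<le> card ?H * (C * b)" by (rule sum_bounded_above) (rule P)
  also have "\<dots> \<le> 1 / a * (C * b)"
  proof (rule mult_right_mono)
    have "real (card ?H) \<le> real (nat \<lfloor>1 / a\<rfloor>)" using H(2) by linarith
    also have "\<dots> \<le> 1 / a" using \<open>a > 0\<close> by (simp add: of_nat_floor)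
    finally show "real (card ?H) \<le> 1 / a" .
  qed (use \<open>b \<ge> 0\<close> in simp)
  finally show ?thesis by simp
qed

text \<open>
  Borel-Cantelli with \<open>r = (1/2)\<^sup>k\<close>: the exceptional sets have masses bounded by a geometric
  series with ratio \<open>2 powr (s - t) < 1\<close>. The heavy threshold uses the half radius \<open>(1/2) ^ Suc k\<close>
  since a radius between \<open>(1/2) ^ Suc k\<close> and \<open>(1/2) ^ k\<close> will be replaced by the larger one.
\<close>

lemma AE_eventually_not_light_near_heavy:
  fixes s t :: real and N C :: nat
  assumes "s < t" "N > 0"
    and mult: "\<And>x r. x \<in> limit_set \<Gamma> E \<Longrightarrow> 0 < r \<Longrightarrow> 2 * r < diameter (E []) \<Longrightarrow>
      finite {w \<in> level_words \<Gamma> E r. E w \<inter> cball x (2 * r) \<noteq> {}} \<and>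
      card {w \<in> level_words \<Gamma> E r. E w \<inter> cball x (2 * r) \<noteq> {}} \<le> C"
  shows "AE i in \<mu>. eventually (\<lambda>k. i \<notin> light_near_heavy ((1/2) ^ k)
    (((1/2) ^ Suc k) powr s / N) (((1/2) ^ k) powr t)) sequentially"
proof -
  let ?B = "\<lambda>k. light_near_heavy ((1/2) ^ k) (((1/2) ^ Suc k) powr s / N) (((1/2) ^ k) powr t)"
  let ?g = "\<lambda>k. C * N * 2 powr s * (2 powr (s - t)) ^ k"
  obtain i where "i \<in> \<Gamma>" using not_empty space_eq by auto
  from diameter_E_pos[OF stake_in_finite_words[OF this, of 0]] have "diameter (E []) > 0" by simp
  then have "eventually (\<lambda>k. 2 * (1/2::real) ^ k < diameter (E [])) sequentially"
    by real_asymp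
  then obtain K where K: "\<And>k. k \<ge> K \<Longrightarrow> 2 * (1/2::real) ^ k < diameter (E [])"
    by (auto simp: eventually_sequentially)
  have bound: "prob (?B k) \<le> ?g k" if "k \<ge> K" for k
  proof -
    have pow: "(1/2::real) ^ k = 2 powr (- k)" for k
      by (simp add: powr_minus powr_realpow power_one_over field_simps)
    have "prob (?B k) \<le> C * ((1/2) ^ k) powr t / (((1/2) ^ Suc k) powr s / N)"
      by (rule prob_light_near_heavy) (use \<open>N > 0\<close> mult K[OF that] in auto)
    also have "\<dots> = C * N * (((1/2) ^ k) powr t / ((1/2) ^ Suc k) powr s)" by simp
    also have "((1/2) ^ k) powr t / ((1/2) ^ Suc k) powr s = 2 powr (s + (s - t) * k)"
      unfolding pow powr_powr powr_diff[symmetric] by (simp add: algebra_simps)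
    also have "\<dots> = 2 powr s * (2 powr (s - t)) ^ k"
      by (simp add: powr_add powr_powr powr_realpow[symmetric])
    finally show ?thesis by simp
  qed
  have "summable ?g"
    using \<open>s < t\<close> by (intro summable_mult summable_geometric) (simp add: powr_less_one)
  then have "summable (\<lambda>k. prob (?B k))"
  proof (rule summable_comparison_test'[of _ K])
    show "norm (prob (?B k)) \<le> ?g k" if "K \<le> k" for k
      using bound[OF that] by (simp only: real_norm_def abs_of_nonneg[OF measure_nonneg])
  qed
  moreover have "emeasure \<mu> (?B k) < \<infinity>" for k
    using emeasure_finite[of "?B k"] by (simp only: less_top infinity_ennreal_def not_False_eq_True)
  ultimately have "AE i in \<mu>. eventually (\<lambda>k. i \<in> space \<mu> - ?B k) sequentially"
    by (intro borel_cantelli_AE1[OF light_near_heavy_sets])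
  then show ?thesis by (rule AE_mp) (intro AE_I2 impI, erule eventually_mono, blast)
qed

section \<open>The lower bound for the dimension\<close>

text \<open>
  If the inequality fails, there are rational exponents \<open>s < t\<close> strictly between the two sides. Choose
  a small radius \<open>r\<close> at which the ball around \<open>\<pi> i\<close> has mass above \<open>r powr s\<close>, and round \<open>r\<close> up to
  \<open>R = (1/2) ^ k\<close>. Then the prefix of \<open>i\<close> of level \<open>R\<close> is light and lies near a heavy word, for
  arbitrarily large \<open>k\<close>.
\<close>

lemma le_lower_local_dim:
  fixes N :: nat
  assumes i: "i \<in> \<Gamma>" and "N > 0"
    and clustering: "\<And>r. r > 0 \<Longrightarrow> finite (level_words_near \<Gamma> E (projection E i) r) \<and>
      card (level_words_near \<Gamma> E (projection E i) r) \<le> N"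
    and ev: "\<And>s t :: rat. 0 \<le> s \<Longrightarrow> s < t \<Longrightarrow> eventually (\<lambda>k. i \<notin> light_near_heavy ((1/2) ^ k)
      (((1/2) ^ Suc k) powr of_rat s / N) (((1/2) ^ k) powr of_rat t)) sequentially"
  shows "liminf (\<lambda>n. log_mass (prob (cylinder_in \<Gamma> (stake n i))) / ereal (ln (diameter (E (stake n i)))))
    \<le> lower_local_dim image_measure (projection E i)" (is "?u \<le> ?l")
proof (rule ccontr)
  let ?x = "projection E i" and ?d = "\<lambda>n. diameter (E (stake n i))"
  let ?m = "\<lambda>r. measure image_measure (cball ?x r)"
  assume "\<not> ?u \<le> ?l"
  then have "?l < ?u" by (simp only: not_le)
  from ereal_dense3[OF this] obtain t :: rat
    where t: "?l < ereal (of_rat t)" "ereal (of_rat t) < ?u" by blast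
  from ereal_dense3[OF t(1)] obtain s :: rat
    where s: "?l < ereal (of_rat s)" "ereal (of_rat s) < ereal (of_rat t)" by blast
  have small: "eventually (\<lambda>r::real. 0 < r \<and> r < e) (at_right 0)" if "e > 0" for e
    using that by (auto simp: eventually_at_right_field)
  \<comment> \<open>Nonnegative exponents make \<open>powr\<close> monotone in the base, which the rounding of radii requires.\<close>
  have "0 \<le> ?l"
    unfolding lower_local_dim_def
  proof (rule Liminf_bounded)
    show "eventually (\<lambda>r. 0 \<le> log_mass (?m r) / ereal (ln r)) (at_right 0)"
      using small[OF zero_less_one]
      by eventually_elim (auto intro!: log_mass_quotient_nonneg simp: measure_image_measure_cball)
  qed
  from le_less_trans[OF this s(1)] have s0: "0 \<le> s" and st: "s < t" using s(2) by (simp_all add: of_rat_less)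

  have pos: "?d n > 0" for n using i by (intro diameter_E_pos) auto
  have "eventually (\<lambda>n. ?d n < 1) sequentially"
    using order_tendstoD(2)[OF diameter_E_tendsto[OF i], of 1] by simp
  with less_LiminfD[OF t(2)]
  have "eventually (\<lambda>n. prob (cylinder_in \<Gamma> (stake n i)) < ?d n powr of_rat t) sequentially"
    by eventually_elim (rule less_powr_if_less_log_mass_quotient[OF measure_nonneg pos])
  then obtain n0 where n0: "\<And>n. n \<ge> n0 \<Longrightarrow> prob (cylinder_in \<Gamma> (stake n i)) < ?d n powr of_rat t"
    by (auto simp: eventually_sequentially)
  obtain k0 where k0: "\<And>k. k \<ge> k0 \<Longrightarrow> i \<notin> light_near_heavy ((1/2) ^ k)
      (((1/2) ^ Suc k) powr of_rat s / N) (((1/2) ^ k) powr of_rat t)"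
    using ev[OF s0 st] by (auto simp: eventually_sequentially)

  \<comment> \<open>A radius below \<open>e\<close> rounds up to \<open>R < 2 e\<close>: the three bounds give \<open>k \<ge> k0\<close>, a level word of length at least \<open>n0\<close>, and the existence of a word of level \<open>R\<close>.\<close>
  define e where "e = Min {(1/2) ^ Suc k0, ?d n0 / 2, ?d 0 / 2}"
  have "e > 0" using pos[of n0] pos[of 0] by (simp add: e_def)
  have e: "e \<le> (1/2) ^ Suc k0" "2 * e \<le> ?d n0" "2 * e \<le> ?d 0" by (auto simp: e_def)
  have "\<not> eventually (\<lambda>r. ereal (of_rat s) \<le> log_mass (?m r) / ereal (ln r)) (at_right 0)"
  proof
    assume "eventually (\<lambda>r. ereal (of_rat s) \<le> log_mass (?m r) / ereal (ln r)) (at_right 0)"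
    then have "ereal (of_rat s) \<le> ?l" unfolding lower_local_dim_def by (rule Liminf_bounded)
    with s(1) show False by simp
  qed
  then have "frequently (\<lambda>r. log_mass (?m r) / ereal (ln r) < ereal (of_rat s)) (at_right 0)"
    by (simp add: frequently_def not_less)
  from frequently_ex[OF frequently_eventually_conj[OF this small[OF \<open>e > 0\<close>]]] obtain r
    where r: "0 < r" "r < e" "log_mass (?m r) / ereal (ln r) < ereal (of_rat s)" by blast
  have "(1/2::real) ^ Suc k0 \<le> (1/2) ^ 0" by (rule power_decreasing) auto
  then have "r < 1" using r e(1) by simp
  have "\<exists>k. (1/2::real) ^ k < r" using real_arch_pow_inv[of r "1/2"] r(1) by auto
  then obtain k1 where "(1/2::real) ^ k1 < r" ..
  moreover have "\<not> (1/2::real) ^ 0 < r" using \<open>r < 1\<close> by simp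
  ultimately obtain k where k: "(1/2) ^ Suc k < r" "\<not> (1/2) ^ k < r"
    using ex_least_nat_less[of "\<lambda>k. (1/2) ^ k < r" k1] by blast
  define R :: real where "R = (1/2) ^ k"
  have R: "0 < R" "R / 2 < r" "r \<le> R" using k by (auto simp: R_def)
  have "k0 \<le> k"
  proof (rule ccontr)
    assume "\<not> k0 \<le> k"
    then have "(1/2::real) ^ Suc k0 \<le> (1/2) ^ Suc k" by (intro power_decreasing) auto
    with k(1) r(2) e(1) show False by linarith
  qed
  have "R < ?d n0" "R < ?d 0" using R r e by linarith+
  then have R0: "R < diameter (E [])" by simp

  obtain v where v: "v \<in> level_words_near \<Gamma> E ?x R" "?m R \<le> N * prob (cylinder_in \<Gamma> v)"
    using heavy_word_near[OF i R(1) R0] clustering[OF R(1)] by blast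
  have "((1/2) ^ Suc k) powr of_rat s \<le> r powr of_rat s"
    using s0 k(1) by (intro powr_mono2) auto
  also have "\<dots> < ?m r"
    by (rule powr_less_if_log_mass_quotient_less[OF measure_nonneg r(1) \<open>r < 1\<close> r(3)])
  also have "?m r \<le> ?m R"
    unfolding measure_image_measure_cball using R(3) by (intro finite_measure_mono) auto
  finally have heavy: "((1/2) ^ Suc k) powr of_rat s / N \<le> prob (cylinder_in \<Gamma> v)"
    using v(2) \<open>N > 0\<close> by (simp add: pos_divide_le_eq mult.commute)

  obtain n where n: "stake n i \<in> level_words \<Gamma> E R"
    using level_word_exists[OF i R(1) R0] ..
  then have dn: "?d n \<le> R" by (simp add: level_words_def)
  have "n0 \<le> n" 
    using diameter_E_stake_mono[OF i, of n n0] dn \<open>R < ?d n0\<close> by (cases "n0 \<le> n") auto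
  then have "prob (cylinder_in \<Gamma> (stake n i)) < ?d n powr of_rat t" by (rule n0)
  also have "\<dots> \<le> R powr of_rat t"
    using s0 st pos[of n] dn by (intro powr_mono2) auto
  finally have light: "prob (cylinder_in \<Gamma> (stake n i)) \<le> R powr of_rat t" by simp
  have "i \<in> cylinder_in \<Gamma> (stake n i)" using i by (simp add: cylinder_in_def)
  then have "i \<in> light_near_heavy R (((1/2) ^ Suc k) powr of_rat s / N) (R powr of_rat t)"
    using v(1) heavy light n unfolding light_near_heavy_def level_words_near_def by blast
  with k0[OF \<open>k0 \<le> k\<close>] show False unfolding R_def by simp
qed

end

section \<open>The dimension formula\<close>

text \<open>
  Borel sets are formed with respect to the subspace topology of \<open>\<Gamma>\<close>, in which traces of cylinders
  are open.
\<close>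

lemma cylinder_in_measurable:
  assumes "borel_regular_measure_on (subtopology (shift_topology \<kappa>) \<Gamma>) \<mu>"
    and "\<Gamma> \<subseteq> shift_space \<kappa>"
  shows "space \<mu> = \<Gamma>" and "cylinder_in \<Gamma> w \<in> sets \<mu>"
proof -
  interpret Metric_space "shift_space \<kappa>" shift_dist by (rule Metric_space_shift_dist)
  show "space \<mu> = \<Gamma>"
    using assms by (auto simp: borel_regular_measure_on_def)
  have "cylinder_in \<Gamma> w = cylinder_in (shift_space \<kappa>) w \<inter> \<Gamma>"
    using assms(2) by (auto simp: cylinder_in_def)
  then have "openin (subtopology (shift_topology \<kappa>) \<Gamma>) (cylinder_in \<Gamma> w)"
    using openin_cylinder_in by (auto simp: openin_subtopology)
  then have "cylinder_in \<Gamma> w \<in> borel_sets_of (subtopology (shift_topology \<kappa>) \<Gamma>)"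
    unfolding borel_sets_of_def by (intro sigma_sets.Basic) simp
  then show "cylinder_in \<Gamma> w \<in> sets \<mu>"
    using assms(1) by (auto simp: borel_regular_measure_on_def)
qed

theorem proposition3p10:
  fixes \<kappa> :: nat
    and \<Gamma> :: "nat stream set"
    and \<mu> :: "nat stream measure"
    and E :: "nat list \<Rightarrow> 'x::complete_space set"
  assumes "\<kappa> \<ge> 2"
    and "\<Gamma> \<subseteq> shift_space \<kappa>"
    and "compactin (shift_topology \<kappa>) \<Gamma>"
    and "stl ` \<Gamma> \<subseteq> \<Gamma>"
    and "prob_space \<mu>"
    and "borel_regular_measure_on (subtopology (shift_topology \<kappa>) \<Gamma>) \<mu>"
    and "moran_construction \<Gamma> E"
    and "\<exists>D::real. D \<ge> 1 \<and> (\<forall>u v. u @ v \<in> finite_words \<Gamma> \<longrightarrow>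
           diameter (E (u @ v)) \<le> D * diameter (E u) * diameter (E v))"
    and "uniform_finite_clustering \<Gamma> E"
  shows "AE i in \<mu>.
           lower_local_dim (distr \<mu> borel (projection E)) (projection E i) =
           liminf (\<lambda>n. log_mass (measure \<mu> (cylinder \<kappa> (stake n i) \<inter> \<Gamma>)) /
                        ereal (ln (diameter (E (stake n i)))))"
proof -
  interpret prob_space \<mu> by fact
  interpret moran_measure \<Gamma> E \<mu>
    using assms cylinder_in_measurable by unfold_locales auto
  obtain D :: real where D: "D \<ge> 1" "\<And>u v. u @ v \<in> finite_words \<Gamma> \<Longrightarrow>
      diameter (E (u @ v)) \<le> D * diameter (E u) * diameter (E v)"
    using assms(8) by blast
  have "moran \<Gamma> E" ..
  then obtain k where "\<forall>u \<in> words_of_length \<Gamma> k. diameter (E u) \<le> 1 / (2 * D)"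
    using diameter_uniformly_small[OF _ assms(3), of E "1 / (2 * D)"] D(1) by auto
  then have ext: "n \<le> m + k" if "i \<in> \<Gamma>" "stake m i \<in> level_words \<Gamma> E (2 * r)"
      "stake n i \<in> level_words \<Gamma> E r" for i m n r
    using level_words_extension_le[OF assms(4) D] that by blast
  \<comment> \<open>The successor makes the bound positive, so that one can divide by it.\<close>
  obtain N0 where "\<And>x r. x \<in> limit_set \<Gamma> E \<Longrightarrow> r > 0 \<Longrightarrow>
      finite (level_words_near \<Gamma> E x r) \<and> card (level_words_near \<Gamma> E x r) \<le> N0"
    using assms(9) unfolding uniform_finite_clustering_def by blast
  then have N: "finite (level_words_near \<Gamma> E x r) \<and> card (level_words_near \<Gamma> E x r) \<le> Suc N0"
    if "x \<in> limit_set \<Gamma> E" "r > 0" for x r using that by (meson le_SucI)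
  define C where "C = Suc N0 * card {u. set u \<subseteq> {1..\<kappa>} \<and> length u \<le> k}"
  have mult: "finite {w \<in> level_words \<Gamma> E r. E w \<inter> cball x (2 * r) \<noteq> {}} \<and>
      card {w \<in> level_words \<Gamma> E r. E w \<inter> cball x (2 * r) \<noteq> {}} \<le> C"
    if "x \<in> limit_set \<Gamma> E" "0 < r" "2 * r < diameter (E [])" for x r
    using level_words_near_double_radius[of "{1..\<kappa>}" k x r "Suc N0"] assms(2) ext that
      N[of x "2 * r"] unfolding C_def shift_space_def by auto
  have "AE i in \<mu>. \<forall>s t :: rat. 0 \<le> s \<longrightarrow> s < t \<longrightarrow>
      eventually (\<lambda>k. i \<notin> light_near_heavy ((1/2) ^ k)
        (((1/2) ^ Suc k) powr of_rat s / Suc N0) (((1/2) ^ k) powr of_rat t)) sequentially"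
    unfolding AE_all_countable
    using AE_eventually_not_light_near_heavy[of _ _ "Suc N0" C] mult
    by (auto simp: of_rat_less simp del: power_Suc)
  then show ?thesis
    using AE_space
  proof eventually_elim
    case (elim i)
    then have i: "i \<in> \<Gamma>" by (simp add: space_eq)
    then have "projection E i \<in> limit_set \<Gamma> E" by (simp add: limit_set_def)
    then show ?case
      using lower_local_dim_le[OF i] le_lower_local_dim[OF i, of "Suc N0"] N elim(1)
      unfolding cylinder_Int_eq_cylinder_in[OF assms(2)] image_measure_def
      by (intro antisym) auto
  qed
qed

end
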